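(* Let $0<\rho\le\mu\le 1$, let $\gamma\in\mathbb{C}\setminus\{0\}$, let $n\ge 3$ be an integer, and let $f(z)=z+\sum_{k=2}^{\infty}a_kz^k$ belong to the class $\mathfrak{R}_{\Sigma,\gamma}^{\mu,\rho}(\widetilde{\mathfrak{p}})$. If $a_m=0$ for all $2\le m\le n-1$, then $$|a_n|\le \frac{|\gamma|\,|\tau|\,\Gamma(\mu+1)\,\Gamma(n+\rho)}{n\,\Gamma(\rho+1)\,\Gamma(n+\mu)},\qquad \tau=\frac{1-\sqrt5}{2}.$$
   Context: Let $\mathbb{U}=\{z\in\mathbb{C}:|z|<1\}$. $\mathcal{A}$ is the class of functions $f$ analytic in $\mathbb{U}$ with $f(0)=f'(0)-1=0$, so $f(z)=z+\sum_{k\ge2}a_kz^k$. A function $f\in\mathcal{A}$ is bi-univalent if both $f$ and $f^{-1}$ are univalent in $\mathbb{U}$ (i.e. $f$ is univalent in $\mathbb{U}$ and its inverse, defined near $0$, extends to a univalent analytic function $g=f^{-1}$ on $\mathbb{U}$); $g(w)=w-a_2w^2+(2a_2^2-a_3)w^3-\cdots$. $\Sigma$ denotes the class of bi-univalent functions. For $F,G$ analytic in $\mathbb{U}$, $F\prec G$ ($F$ is subordinate to $G$) means there is an analytic $\varpi$ on $\mathbb{U}$ with $\varpi(0)=0$, $|\varpi(z)|<1$ and $F(z)=G(\varpi(z))$ for $z\in\mathbb{U}$. The fractional derivative of order $\delta$, $0\le\delta<1$, is $D_z^{\delta}f(z)=\frac{1}{\Gamma(1-\delta)}\frac{d}{dz}\int_0^z\frac{f(\xi)}{(z-\xi)^{\delta}}\,d\xi$.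 The Tremblay fractional derivative operator is $I_z^{\mu,\rho}f(z)=\frac{\Gamma(\rho)}{\Gamma(\mu)}z^{1-\rho}D_z^{\mu-\rho}\left(z^{\mu-1}f(z)\right)$; on $f(z)=z+\sum_{k\ge2}a_kz^k\in\mathcal{A}$ it acts by $$I_z^{\mu,\rho}f(z)=\frac{\mu}{\rho}z+\sum_{k=2}^\infty\frac{\Gamma(\rho)\Gamma(k+\mu)}{\Gamma(\mu)\Gamma(k+\rho)}a_kz^k .$$ Let $\tau=\frac{1-\sqrt5}{2}$ and $\widetilde{\mathfrak{p}}(z)=\frac{1+\tau^2z^2}{1-\tau z-\tau^2z^2}$. For $\gamma\in\mathbb{C}\setminus\{0\}$, the class $\mathfrak{R}_{\Sigma,\gamma}^{\mu,\rho}(\widetilde{\mathfrak{p}})$ consists of all $f\in\Sigma$ such that, with $g=f^{-1}$, $$1+\frac1\gamma\left(\frac{\rho\,(I_z^{\mu,\rho}f(z))'}{\mu}-1\right)\prec\widetilde{\mathfrak{p}}(z)\quad\text{and}\quad 1+\frac1\gamma\left(\frac{\rho\,(I_z^{\mu,\rho}g(w))'}{\mu}-1\right)\prec\widetilde{\mathfrak{p}}(w).$$ *)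

theory Defs
  imports "HOL-Complex_Analysis.Complex_Analysis"
begin

abbreviation unit_disc :: "complex set" where
  "unit_disc \<equiv> ball 0 1"

definition class_A :: "(complex \<Rightarrow> complex) set" where
  "class_A = {f. f holomorphic_on unit_disc \<and> f 0 = 0 \<and> deriv f 0 = 1}"

definition univalent :: "(complex \<Rightarrow> complex) \<Rightarrow> bool" where
  "univalent f \<longleftrightarrow> f holomorphic_on unit_disc \<and> inj_on f unit_disc"

(* g extends the germ at 0 of the inverse of f to the whole disc.  Outside a neighbourhood
   of 0 nothing is required of g beyond analyticity and univalence: in particular g may take
   values outside the disc.  By the identity theorem, g is unique on the disc. *)
definition univalent_inverse :: "(complex \<Rightarrow> complex) \<Rightarrow> (complex \<Rightarrow> complex) \<Rightarrow> bool" where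
  "univalent_inverse f g \<longleftrightarrow>
     univalent g \<and>
     (\<forall>\<^sub>F w in nhds 0. w \<in> f ` unit_disc \<and> g w = inv_into unit_disc f w)"

definition class_Sigma :: "(complex \<Rightarrow> complex) set" where
  "class_Sigma = {f \<in> class_A. univalent f \<and> (\<exists>g. univalent_inverse f g)}"

definition subordinate :: "(complex \<Rightarrow> complex) \<Rightarrow> (complex \<Rightarrow> complex) \<Rightarrow> bool"
    (infix "\<prec>\<^sub>s" 50) where
  "F \<prec>\<^sub>s G \<longleftrightarrow>
     F holomorphic_on unit_disc \<and> G holomorphic_on unit_disc \<and>
     (\<exists>\<omega>. \<omega> holomorphic_on unit_disc \<and> \<omega> 0 = 0 \<and>
          (\<forall>z\<in>unit_disc. norm (\<omega> z) < 1 \<and> F z = G (\<omega> z)))"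

(* The integral is taken along the segment from 0 to z, with the principal branch of the
   power; it may be improper at both ends. *)
definition frac_deriv :: "real \<Rightarrow> (complex \<Rightarrow> complex) \<Rightarrow> complex \<Rightarrow> complex" where
  "frac_deriv \<delta> f z =
     1 / of_real (Gamma (1 - \<delta>)) *
     deriv (\<lambda>u. contour_integral (linepath 0 u) (\<lambda>\<xi>. f \<xi> / (u - \<xi>) powr of_real \<delta>)) z"

(* With principal branches the defining formula
     Gamma \<rho> / Gamma \<mu> * z^(1 - \<rho>) * D^(\<mu> - \<rho>) (z^(\<mu> - 1) * f z)
   makes sense on the disc slit along the non-positive real axis (the function being
   differentiated jumps across the slit).  The operator yields the analytic function on the
   whole disc given there by this formula; it is unique by the identity theorem.  It exists for
   f holomorphic on the disc and 0 < \<rho> \<le> \<mu> \<le> 1: the substitution \<xi> = t * z turns the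
   integral into z^\<rho> * H z with H holomorphic on the disc, and the formula into a constant
   times \<rho> * H z + z * H' z. *)
definition tremblay :: "real \<Rightarrow> real \<Rightarrow> (complex \<Rightarrow> complex) \<Rightarrow> complex \<Rightarrow> complex" where
  "tremblay \<mu> \<rho> f =
     (SOME h. h holomorphic_on unit_disc \<and>
        (\<forall>z \<in> unit_disc - \<real>\<^sub>\<le>\<^sub>0.
           h z = of_real (Gamma \<rho> / Gamma \<mu>) * z powr of_real (1 - \<rho>) *
                 frac_deriv (\<mu> - \<rho>) (\<lambda>\<xi>. \<xi> powr of_real (\<mu> - 1) * f \<xi>) z))"

definition tau :: real where
  "tau = (1 - sqrt 5) / 2"

definition p_tilde :: "complex \<Rightarrow> complex" where
  "p_tilde z =
     (1 + of_real tau ^ 2 * z ^ 2) / (1 - of_real tau * z - of_real tau ^ 2 * z ^ 2)"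

definition class_R ::
    "complex \<Rightarrow> real \<Rightarrow> real \<Rightarrow> (complex \<Rightarrow> complex) \<Rightarrow> (complex \<Rightarrow> complex) set" where
  "class_R \<gamma> \<mu> \<rho> p =
     {f \<in> class_Sigma. \<exists>g. univalent_inverse f g \<and>
        (\<lambda>z. 1 + 1 / \<gamma> * (of_real \<rho> * deriv (tremblay \<mu> \<rho> f) z / of_real \<mu> - 1)) \<prec>\<^sub>s p \<and>
        (\<lambda>w. 1 + 1 / \<gamma> * (of_real \<rho> * deriv (tremblay \<mu> \<rho> g) w / of_real \<mu> - 1)) \<prec>\<^sub>s p}"

end

theory Submission
  imports Defs
begin

text \<open>
  If all coefficients of \<open>f\<close> strictly between the first and the \<open>n\<close>-th vanish, then the left-hand
  side of the subordination for \<open>f\<close> is \<open>1 + c z\<^sup>n\<^sup>-\<^sup>1 + \<dots>\<close>, where \<open>c\<close> is a known nonzero multiple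
  of \<open>a\<^sub>n\<close>. Write it as \<open>p_tilde \<circ> \<omega>\<close>. Since \<open>p_tilde w = 1 + \<tau> w + \<dots>\<close> with \<open>\<tau> \<noteq> 0\<close>,
  the Schwarz function \<open>\<omega>\<close> must itself start at order \<open>n - 1\<close>, and \<open>c\<close> is \<open>\<tau>\<close> times its leading
  coefficient (lemma \<open>fps_compose_leading_coeff\<close>). A function bounded by 1 on the unit disc has
  Taylor coefficients bounded by 1, so \<open>\<bar>c\<bar> \<le> \<bar>\<tau>\<bar>\<close>
  (lemma \<open>subordinate_leading_coeff_bound\<close>), which is the estimate.

  The rest is the identification of \<open>c\<close>, that is, of the coefficients of the Tremblay operator
  (theorem \<open>tremblay_sums\<close>). Substituting \<open>\<xi> = t u\<close> in the fractional integral turns it into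
  \<open>u\<^sup>\<rho> H u\<close>, where \<open>H u\<close> averages \<open>f\<close> over the segment from 0 to \<open>u\<close> against a beta density. Hence
  \<open>H\<close> multiplies the \<open>k\<close>-th coefficient of \<open>f\<close> by a beta integral, and the operator is a constant
  times \<open>\<rho> H u + u H' u\<close>, which multiplies it further by \<open>\<rho> + k\<close>; the gamma factors then combine
  to the stated quotient.
\<close>

section \<open>The leading coefficient under subordination\<close>

text \<open>Cauchy's inequality on the circle of radius \<open>r\<close> gives the bound \<open>r\<^sup>-\<^sup>k\<close>; let \<open>r\<close> tend to 1.\<close>

lemma taylor_coeff_bound_unit_disc:
  assumes "w holomorphic_on unit_disc" and "\<And>z. z \<in> unit_disc \<Longrightarrow> norm (w z) \<le> 1"
    and "w has_fps_expansion W"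
  shows "norm (fps_nth W k) \<le> 1"
proof -
  have bound: "norm (fps_nth W k) * r ^ k \<le> 1" if r: "0 < r" "r < 1" for r :: real
  proof -
    have "norm ((deriv ^^ k) w 0) \<le> fact k * 1 / r ^ k"
    proof (rule Cauchy_inequality)
      show "w holomorphic_on ball 0 r"
        by (rule holomorphic_on_subset[OF assms(1)]) (use r in auto)
      show "continuous_on (cball 0 r) w"
        by (rule holomorphic_on_imp_continuous_on, rule holomorphic_on_subset[OF assms(1)])
          (use r in auto)
    qed (use r assms(2) in auto)
    then show ?thesis
      using r by (simp add: fps_nth_fps_expansion[OF assms(3)] norm_divide field_simps)
  qed
  have "((\<lambda>r. norm (fps_nth W k) * r ^ k) \<longlongrightarrow> norm (fps_nth W k) * 1 ^ k) (at_left 1)"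
    by (intro tendsto_intros)
  moreover have "\<forall>\<^sub>F r in at_left (1::real). norm (fps_nth W k) * r ^ k \<le> 1"
    by (rule eventually_mono[OF eventually_at_left_real[of 0 1]]) (auto intro: bound)
  ultimately show ?thesis
    using tendsto_upperbound[of "\<lambda>r. norm (fps_nth W k) * r ^ k" _ "at_left 1" 1] by simp
qed

text \<open>
  Factor \<open>P - P\<^sub>0 = X Q\<close>, so that \<open>P \<circ> W - P\<^sub>0 = W \<cdot> (Q \<circ> W)\<close>. The second factor has constant term
  \<open>P\<^sub>1\<close>, a unit, so the product starts at the same order as \<open>W\<close>.
\<close>

lemma fps_compose_leading_coeff:
  fixes P W :: "'a :: field fps"
  assumes W0: "fps_nth W 0 = 0" and P1: "fps_nth P 1 \<noteq> 0"
    and vanish: "\<And>k. 0 < k \<Longrightarrow> k < m \<Longrightarrow> fps_nth (fps_compose P W) k = 0" and "0 < m"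
  shows "fps_nth (fps_compose P W) m = fps_nth P 1 * fps_nth W m"
proof -
  define Q where "Q = fps_shift 1 P"
  have "P = fps_const (fps_nth P 0) + Q * fps_X"
    by (rule fps_ext) (auto simp: Q_def fps_mult_fps_X_commute)
  then have "fps_compose P W = fps_compose (fps_const (fps_nth P 0) + Q * fps_X) W"
    by simp
  also have "\<dots> = fps_const (fps_nth P 0) + fps_compose Q W * W"
    using W0 by (simp add: fps_compose_add_distrib fps_compose_mult_distrib)
  finally have comp: "fps_compose P W = fps_const (fps_nth P 0) + fps_compose Q W * W" .
  have step: "fps_nth (fps_compose P W) k = fps_nth P 1 * fps_nth W k"
    if "0 < k" and low: "\<And>j. j < k \<Longrightarrow> fps_nth W j = 0" for k
  proof -
    have "fps_nth (fps_compose P W) k = fps_nth (W * fps_compose Q W) k"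
      using \<open>0 < k\<close> by (simp add: comp mult.commute)
    also have "\<dots> = (\<Sum>i\<in>{k}. fps_nth W i * fps_nth (fps_compose Q W) (k - i))"
      unfolding fps_mult_nth by (rule sum.mono_neutral_right) (auto simp: low)
    finally show ?thesis by (simp add: Q_def)
  qed
  have "fps_nth W k = 0" if "k < m" for k
    using that
  proof (induction k rule: less_induct)
    case (less k)
    show ?case
    proof (cases "k = 0")
      case False
      have "fps_nth P 1 * fps_nth W k = 0"
        using step[of k] vanish[of k] less False by simp
      then show ?thesis using P1 by simp
    qed (simp add: W0)
  qed
  then show ?thesis using step \<open>0 < m\<close> by blast
qed

text \<open>
  The Schwarz function has a leading coefficient of modulus at most 1. The condition \<open>G' 0 \<noteq> 0\<close>
  forces it to vanish to the same order as \<open>F - F 0\<close>; for \<open>G z = z\<^sup>2\<close> and \<open>m = 2\<close> the bound would fail.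
\<close>

lemma subordinate_leading_coeff_bound:
  assumes sub: "F \<prec>\<^sub>s G" and A: "F has_fps_expansion A" and G': "deriv G 0 \<noteq> 0"
    and "0 < m" and vanish: "\<And>k. 0 < k \<Longrightarrow> k < m \<Longrightarrow> fps_nth A k = 0"
  shows "norm (fps_nth A m) \<le> norm (deriv G 0)"
proof -
  obtain w where G: "G holomorphic_on unit_disc"
    and w: "w holomorphic_on unit_disc" "w 0 = 0"
      "\<And>z. z \<in> unit_disc \<Longrightarrow> norm (w z) < 1" "\<And>z. z \<in> unit_disc \<Longrightarrow> F z = G (w z)"
    using sub unfolding subordinate_def by blast
  define P W where "P = fps_expansion G 0" and "W = fps_expansion w 0"
  have P: "G has_fps_expansion P"
    unfolding P_def by (rule has_fps_expansion_fps_expansion[of unit_disc]) (use G in auto)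
  have W: "w has_fps_expansion W"
    unfolding W_def by (rule has_fps_expansion_fps_expansion[of unit_disc]) (use w in auto)
  have W0: "fps_nth W 0 = 0" using fps_nth_fps_expansion[OF W, of 0] w by simp
  have P1: "fps_nth P 1 = deriv G 0" using fps_nth_fps_expansion[OF P, of 1] by simp
  have "(G \<circ> w) has_fps_expansion fps_compose P W"
    by (rule has_fps_expansion_compose[OF P W W0])
  moreover have "\<forall>\<^sub>F z in nhds 0. (G \<circ> w) z = F z"
    by (rule eventually_mono[OF eventually_nhds_in_open[of unit_disc 0]]) (auto simp: w)
  ultimately have "F has_fps_expansion fps_compose P W"
    using has_fps_expansion_cong[of "G \<circ> w" F "fps_compose P W" "fps_compose P W"] by simp
  then have A_eq: "A = fps_compose P W" using A fps_expansion_unique_complex by blast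
  have "fps_nth A m = deriv G 0 * fps_nth W m"
    using fps_compose_leading_coeff[OF W0, of P m] vanish \<open>0 < m\<close> G' P1 A_eq by simp
  moreover have "norm (fps_nth W m) \<le> 1"
    by (rule taylor_coeff_bound_unit_disc[OF w(1) _ W]) (simp add: less_imp_le w(3))
  ultimately show ?thesis by (simp add: norm_mult mult_left_le)
qed

section \<open>The Tremblay operator on power series\<close>

text \<open>
  Averaging the dilations \<open>z \<mapsto> t z\<close> against a weight multiplies Taylor coefficients by the moments
  of the weight. Sum and integral may be exchanged by dominated convergence: on \<open>[0, 1]\<close> the partial
  sums are at most \<open>w t\<close> times the absolute sum of the series at \<open>z\<close>.
\<close>

lemma weighted_dilation_integral_sums:
  fixes f :: "complex \<Rightarrow> complex" and w M :: "_ \<Rightarrow> real"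
  assumes f: "\<And>z. z \<in> unit_disc \<Longrightarrow> (\<lambda>k. b k * z ^ k) sums f z"
    and w: "\<And>t. t \<in> {0..1} \<Longrightarrow> 0 \<le> w t"
    and M: "\<And>k. ((\<lambda>t. w t * t ^ k) has_integral M k) {0..1}"
    and z: "z \<in> unit_disc"
  shows "(\<lambda>k. of_real (M k) * b k * z ^ k) sums
    integral {0..1} (\<lambda>t. of_real (w t) * f (of_real t * z))"
proof -
  define S where "S n t = (\<Sum>k<n. of_real (w t * t ^ k) * (b k * z ^ k))" for n and t :: real
  have S_int: "(S n has_integral (\<Sum>k<n. of_real (M k) * (b k * z ^ k))) {0..1}" for n
    unfolding S_def
    by (intro has_integral_sum has_integral_mult_left has_integral_of_real M) auto
  \<comment> \<open>Absolute convergence at \<open>z\<close> comes from convergence at a point of larger modulus.\<close>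
  obtain r where r: "norm z < r" "r < 1" using z dense[of "norm z" 1] by auto
  have r': "complex_of_real r \<in> unit_disc" "norm z < norm (complex_of_real r)"
    using r norm_ge_zero[of z] by (auto simp del: norm_ge_zero)
  have summ: "summable (\<lambda>k. norm (b k * z ^ k))"
    by (rule powser_insidea[OF sums_summable[OF f[OF r'(1)]] r'(2)])
  define K where "K = (\<Sum>k. norm (b k * z ^ k))"
  have "(\<lambda>n. integral {0..1} (S n)) \<longlonglongrightarrow>
      integral {0..1} (\<lambda>t. of_real (w t) * f (of_real t * z))"
  proof (rule dominated_convergence(2))
    show "S n integrable_on {0..1}" for n using S_int by blast
    have "((\<lambda>t. w t * t ^ 0) has_integral M 0) {0..1}" by (rule M)
    then have "w integrable_on {0..1}" by auto
    then show "(\<lambda>t. w t * K) integrable_on {0..1}" by (rule integrable_on_mult_left)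
    show "norm (S n t) \<le> w t * K" if t: "t \<in> {0..1}" for n t
    proof -
      have "norm (S n t) \<le> (\<Sum>k<n. w t * norm (b k * z ^ k))"
        unfolding S_def
      proof (rule sum_norm_le)
        fix k
        have "w t * t ^ k \<le> w t" "0 \<le> w t * t ^ k"
          using w[OF t] t by (auto simp: mult_left_le power_le_one)
        then show "norm (of_real (w t * t ^ k) * (b k * z ^ k)) \<le> w t * norm (b k * z ^ k)"
          unfolding norm_mult[of "of_real _"] norm_of_real by (intro mult_right_mono) auto
      qed
      also have "\<dots> = w t * (\<Sum>k<n. norm (b k * z ^ k))" by (simp add: sum_distrib_left)
      also have "\<dots> \<le> w t * K"
        unfolding K_def by (intro mult_left_mono w t sum_le_suminf summ) auto
      finally show ?thesis .
    qed
    show "(\<lambda>n. S n t) \<longlonglongrightarrow> of_real (w t) * f (of_real t * z)" if t: "t \<in> {0..1}" for t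
    proof -
      have "norm (of_real t * z) \<le> norm z"
        using t by (simp add: norm_mult mult_left_le_one_le)
      then have "of_real t * z \<in> unit_disc" using z by simp
      from sums_mult[OF f[OF this], of "of_real (w t)"] show ?thesis
        unfolding sums_def S_def by (simp add: power_mult_distrib mult_ac)
    qed
  qed
  then show ?thesis
    unfolding sums_def integral_unique[OF S_int] by (simp add: mult_ac)
qed

text \<open>
  Substitution of \<open>\<xi> = t u\<close>. Both powers are of positive multiples of \<open>u\<close>, for which the principal
  branch is multiplicative, so the powers of \<open>u\<close> can be taken out of the integral on either side of the
  branch cut.
\<close>

lemma frac_integral_linepath:
  fixes \<mu> \<delta> :: real
  assumes "u \<noteq> 0"
  shows "contour_integral (linepath 0 u)
      (\<lambda>\<xi>. \<xi> powr of_real (\<mu> - 1) * f \<xi> / (u - \<xi>) powr of_real \<delta>) =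
    u powr of_real (\<mu> - \<delta>) *
      integral {0..1} (\<lambda>t. of_real (t powr (\<mu> - 1) * (1 - t) powr (- \<delta>)) * f (of_real t * u))"
    (is "_ = _ * integral _ ?w")
proof -
  have powr: "(of_real t * u) powr of_real s = of_real (t powr s) * u powr of_real s"
    if "0 < t" for t s :: real
    using that assms
    by (simp add: powr_def Ln_times_of_real Ln_of_real distrib_left exp_add flip: exp_of_real)
  have "contour_integral (linepath 0 u)
      (\<lambda>\<xi>. \<xi> powr of_real (\<mu> - 1) * f \<xi> / (u - \<xi>) powr of_real \<delta>) =
    integral {0..1} (\<lambda>t. (of_real t * u) powr of_real (\<mu> - 1) * f (of_real t * u)
      / (u - of_real t * u) powr of_real \<delta> * u)"
    by (simp add: contour_integral_integral linepath_def scaleR_conv_of_real)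
  also have "\<dots> = integral {0..1} (\<lambda>t. u powr of_real (\<mu> - \<delta>) * ?w t)"
  proof (rule integral_spike[of "{0, 1}"])
    fix t :: real assume "t \<in> {0..1} - {0, 1}"
    then have t: "0 < t" "t < 1" by auto
    have "u - of_real t * u = of_real (1 - t) * u" by (simp add: algebra_simps)
    moreover have "u powr of_real (\<mu> - \<delta>) = u powr of_real (\<mu> - 1) * u / u powr of_real \<delta>"
      using assms powr_add[of u "of_real (\<mu> - 1)" 1] by (simp add: powr_diff)
    ultimately show "u powr of_real (\<mu> - \<delta>) * ?w t = (of_real t * u) powr of_real (\<mu> - 1) *
        f (of_real t * u) / (u - of_real t * u) powr of_real \<delta> * u"
      using t powr[of t "\<mu> - 1"] powr[of "1 - t" \<delta>] by (simp add: powr_minus field_simps)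
  qed auto
  finally show ?thesis by simp
qed

lemma beta_moment:
  fixes \<mu> \<delta> :: real
  assumes "0 < \<mu>" "\<delta> < 1"
  shows "((\<lambda>t. t powr (\<mu> - 1) * (1 - t) powr (- \<delta>) * t ^ k) has_integral
    Beta (\<mu> + real k) (1 - \<delta>)) {0..1}"
proof (rule has_integral_eq[OF _ has_integral_Beta_real])
  fix t :: real assume t: "t \<in> {0..1}"
  show "t powr (\<mu> + real k - 1) * (1 - t) powr (1 - \<delta> - 1) =
      t powr (\<mu> - 1) * (1 - t) powr (- \<delta>) * t ^ k"
  proof (cases "t = 0")
    case False
    then show ?thesis using t
      by (simp add: powr_realpow[symmetric] powr_add[symmetric] algebra_simps)
  qed simp
qed (use assms in auto)

text \<open>
  The operator is given by a choice of a holomorphic extension from the slit disc, so besides the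
  coefficients one has to show that such an extension exists. Both come from the explicit candidate
  \<open>h\<close>: by the identity theorem, any chosen extension equals \<open>h\<close>.
\<close>

theorem tremblay_sums:
  fixes \<mu> \<rho> :: real
  assumes \<rho>: "0 < \<rho>" and \<mu>: "0 < \<mu>" and \<delta>: "\<mu> - \<rho> < 1"
    and f: "\<And>z. z \<in> unit_disc \<Longrightarrow> (\<lambda>k. b k * z ^ k) sums f z"
    and z: "z \<in> unit_disc"
  shows "(\<lambda>k. of_real (Gamma \<rho> * Gamma (real k + \<mu>) / (Gamma \<mu> * Gamma (real k + \<rho>))) *
    b k * z ^ k) sums tremblay \<mu> \<rho> f z"
proof -
  define w where "w t = t powr (\<mu> - 1) * (1 - t) powr (- (\<mu> - \<rho>))" for t :: real
  define B where "B k = Beta (\<mu> + real k) (1 - (\<mu> - \<rho>))" for k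
  define H where "H u = integral {0..1} (\<lambda>t. of_real (w t) * f (of_real t * u))" for u
  have H_sums: "(\<lambda>k. of_real (B k) * b k * u ^ k) sums H u" if "u \<in> unit_disc" for u
    unfolding H_def B_def
    by (rule weighted_dilation_integral_sums[OF f _ _ that])
      (use beta_moment[OF \<mu> \<delta>] in \<open>simp_all add: w_def\<close>)
  have H_hol: "H holomorphic_on unit_disc"
    by (rule power_series_holomorphic[where a = "\<lambda>k. of_real (B k) * b k"]) (use H_sums in simp)
  define C where "C = Gamma \<rho> / (Gamma \<mu> * Gamma (1 - (\<mu> - \<rho>)))"
  define h where "h u = of_real C * (of_real \<rho> * H u + u * deriv H u)" for u
  have h_hol: "h holomorphic_on unit_disc"
    unfolding h_def by (intro holomorphic_intros H_hol) auto
  have H_deriv: "(H has_field_derivative deriv H u) (at u)" if "u \<in> unit_disc" for u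
    using that by (intro holomorphic_derivI[OF H_hol]) auto
  \<comment> \<open>The factor \<open>\<rho> + k\<close> from the differentiation lowers the argument of the gamma function in the
    denominator of the beta integral by one.\<close>
  have coeff: "C * ((\<rho> + real k) * B k) =
      Gamma \<rho> * Gamma (real k + \<mu>) / (Gamma \<mu> * Gamma (real k + \<rho>))" for k
  proof -
    have arg: "\<mu> + real k + (1 - (\<mu> - \<rho>)) = real k + \<rho> + 1" by simp
    have plus1: "Gamma (real k + \<rho> + 1) = (real k + \<rho>) * Gamma (real k + \<rho>)"
      by (rule Gamma_plus1) (use \<rho> in \<open>auto simp: nonpos_Ints_def\<close>)
    have "B k = Gamma (real k + \<mu>) * Gamma (1 - (\<mu> - \<rho>)) / ((real k + \<rho>) * Gamma (real k + \<rho>))"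
      unfolding B_def Beta_def arg plus1 by (simp only: add.commute)
    moreover have "Gamma (1 - (\<mu> - \<rho>)) \<noteq> 0" "real k + \<rho> \<noteq> 0"
      using \<rho> \<delta> Gamma_real_pos[of "1 - (\<mu> - \<rho>)"] by linarith+
    ultimately show ?thesis by (simp add: C_def add.commute[of \<rho>])
  qed
  have h_sums: "(\<lambda>k. of_real (Gamma \<rho> * Gamma (real k + \<mu>) / (Gamma \<mu> * Gamma (real k + \<rho>))) *
    b k * u ^ k) sums h u" if u: "u \<in> unit_disc" for u
  proof -
    have "(\<lambda>k. diffs (\<lambda>k. of_real (B k) * b k) k * u ^ k) sums deriv H u"
      by (rule termdiffs_sums_strong[of 1 _ H]) (use u H_sums H_deriv in auto)
    from sums_mult[OF this, of u]
    have "(\<lambda>k. of_nat (Suc k) * (of_real (B (Suc k)) * b (Suc k)) * u ^ Suc k) sums (u * deriv H u)"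
      by (simp add: diffs_def mult_ac)
    then have "(\<lambda>k. of_nat k * (of_real (B k) * b k) * u ^ k) sums (u * deriv H u)"
      by (subst (asm) sums_Suc_iff) simp
    from sums_mult[OF sums_add[OF sums_mult[OF H_sums[OF u], of "of_real \<rho>"] this], of "of_real C"]
    have "(\<lambda>k. of_real (C * ((\<rho> + real k) * B k)) * b k * u ^ k) sums h u"
      unfolding h_def by (simp add: algebra_simps)
    then show ?thesis unfolding coeff .
  qed
  \<comment> \<open>Off the slit the power of \<open>u\<close> is differentiable, and the product rule applied to
    \<open>u\<^sup>\<rho> H u\<close> turns the defining formula into \<open>h\<close>.\<close>
  let ?T = "\<lambda>z. of_real (Gamma \<rho> / Gamma \<mu>) * z powr of_real (1 - \<rho>) *
    frac_deriv (\<mu> - \<rho>) (\<lambda>\<xi>. \<xi> powr of_real (\<mu> - 1) * f \<xi>) z"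
  let ?slit = "unit_disc - \<real>\<^sub>\<le>\<^sub>0"
  have open_slit: "open ?slit" by (intro open_Diff) auto
  have h_eq: "h u = ?T u" if u: "u \<in> ?slit" for u
  proof -
    have u0: "u \<noteq> 0" and ud: "u \<in> unit_disc" and ur: "u \<notin> \<real>\<^sub>\<le>\<^sub>0" using u by auto
    have "((\<lambda>u. u powr of_real \<rho> * H u) has_field_derivative
        u powr of_real \<rho> * deriv H u + of_real \<rho> * u powr (of_real \<rho> - 1) * H u) (at u)"
      using ur by (auto intro!: derivative_eq_intros H_deriv[OF ud] simp: algebra_simps)
    moreover have "\<forall>\<^sub>F v in nhds u. v powr of_real \<rho> * H v = contour_integral (linepath 0 v)
        (\<lambda>\<xi>. \<xi> powr of_real (\<mu> - 1) * f \<xi> / (v - \<xi>) powr of_real (\<mu> - \<rho>))"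
      using eventually_nhds_in_open[OF open_slit u]
    proof eventually_elim
      case (elim v)
      then have "v \<noteq> 0" by auto
      from frac_integral_linepath[OF this, of \<mu> f "\<mu> - \<rho>"] show ?case
        by (simp add: H_def w_def)
    qed
    ultimately have "((\<lambda>v. contour_integral (linepath 0 v)
        (\<lambda>\<xi>. \<xi> powr of_real (\<mu> - 1) * f \<xi> / (v - \<xi>) powr of_real (\<mu> - \<rho>)))
      has_field_derivative
        u powr of_real \<rho> * deriv H u + of_real \<rho> * u powr (of_real \<rho> - 1) * H u) (at u)"
      by (subst (asm) DERIV_cong_ev[OF refl _ refl])
    from DERIV_imp_deriv[OF this] have "?T u = of_real C * (u powr of_real (1 - \<rho>) *
        (u powr of_real \<rho> * deriv H u + of_real \<rho> * u powr (of_real \<rho> - 1) * H u))"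
      unfolding frac_deriv_def C_def by simp
    also have "\<dots> = h u"
    proof -
      have "u powr of_real \<rho> * u powr of_real (1 - \<rho>) = u"
        using u0 powr_add[of u "of_real \<rho>" "of_real (1 - \<rho>)"] by simp
      moreover have "u powr of_real (1 - \<rho>) * u powr (of_real \<rho> - 1) = 1"
        using u0 powr_add[of u "of_real (1 - \<rho>)" "of_real \<rho> - 1"] by simp
      ultimately show ?thesis
        unfolding h_def by (simp add: distrib_left mult.left_commute mult.assoc[symmetric])
    qed
    finally show ?thesis by simp
  qed
  have "tremblay \<mu> \<rho> f holomorphic_on unit_disc \<and> (\<forall>z\<in>?slit. tremblay \<mu> \<rho> f z = ?T z)"
    unfolding tremblay_def by (rule someI[of _ h]) (use h_hol h_eq in auto)
  moreover have "1 / 2 \<in> ?slit" by (auto simp: complex_nonpos_Reals_iff)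
  then have "?slit \<noteq> {}" by blast
  ultimately have "tremblay \<mu> \<rho> f z = h z"
    by (intro analytic_continuation_open[OF open_slit, of unit_disc _ h z])
      (use h_hol h_eq z in auto)
  then show ?thesis using h_sums[OF z] by simp
qed

section \<open>The coefficient estimate\<close>

lemma has_field_derivative_p_tilde_0: "(p_tilde has_field_derivative of_real tau) (at 0)"
  unfolding p_tilde_def by (auto intro!: derivative_eq_intros simp: power2_eq_square)

theorem theorem7:
  fixes \<mu> \<rho> :: real and \<gamma> :: complex and n :: nat
    and f :: "complex \<Rightarrow> complex" and a :: "nat \<Rightarrow> complex"
  assumes "0 < \<rho>" and "\<rho> \<le> \<mu>" and "\<mu> \<le> 1"
    and "\<gamma> \<noteq> 0"
    and "n \<ge> 3"
    and "f \<in> class_R \<gamma> \<mu> \<rho> p_tilde"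
    and "\<And>z. z \<in> unit_disc \<Longrightarrow> (\<lambda>k. a (k + 2) * z ^ (k + 2)) sums (f z - z)"
    and "\<And>m. 2 \<le> m \<Longrightarrow> m \<le> n - 1 \<Longrightarrow> a m = 0"
  shows "norm (a n) \<le>
    norm \<gamma> * \<bar>tau\<bar> * Gamma (\<mu> + 1) * Gamma (real n + \<rho>) /
    (real n * Gamma (\<rho> + 1) * Gamma (real n + \<mu>))"
proof -
  have \<mu>: "0 < \<mu>" using assms by simp
  \<comment> \<open>The hypothesis on the series leaves \<open>a 0\<close> and \<open>a 1\<close> arbitrary.\<close>
  define b where "b k = (if k = 0 then 0 else if k = 1 then 1 else a k)" for k
  have f_sums: "(\<lambda>k. b k * z ^ k) sums f z" if "z \<in> unit_disc" for z
  proof -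
    have "(\<lambda>k. b (k + 2) * z ^ (k + 2)) sums (f z - z)"
      using assms(7)[OF that] by (simp add: b_def)
    then show ?thesis
      by (subst (asm) sums_iff_shift) (simp add: b_def numeral_2_eq_2)
  qed
  define c where "c k = Gamma \<rho> * Gamma (real k + \<mu>) / (Gamma \<mu> * Gamma (real k + \<rho>))" for k
  define A where "A = Abs_fps (\<lambda>k. of_real (c k) * b k)"
  have "tremblay \<mu> \<rho> f has_fps_expansion A"
  proof (rule has_fps_expansionI)
    have "\<forall>\<^sub>F u in nhds (0::complex). u \<in> unit_disc"
      by (rule eventually_nhds_in_open) auto
    then show "\<forall>\<^sub>F u in nhds 0. (\<lambda>k. fps_nth A k * u ^ k) sums tremblay \<mu> \<rho> f u"
    proof eventually_elim
      case (elim u)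
      from tremblay_sums[OF assms(1) \<mu> _ f_sums this] show ?case
        using assms by (simp add: A_def c_def)
    qed
  qed
  define D where "D = 1 + fps_const (1 / \<gamma>) *
    (fps_const (of_real \<rho>) * fps_deriv A * fps_const (1 / of_real \<mu>) - 1)"
  let ?F = "\<lambda>z. 1 + 1 / \<gamma> * (of_real \<rho> * deriv (tremblay \<mu> \<rho> f) z / of_real \<mu> - 1)"
  have "(\<lambda>z. 1 + 1 / \<gamma> * (of_real \<rho> * deriv (tremblay \<mu> \<rho> f) z * (1 / of_real \<mu>) - 1))
      has_fps_expansion D"
    unfolding D_def by (intro fps_expansion_intros) fact
  then have D: "?F has_fps_expansion D" by simp
  have D_nth: "fps_nth D k = of_real (\<rho> / \<mu> * real (Suc k) * c (Suc k)) * b (Suc k) / \<gamma>"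
    if "0 < k" for k
    using that by (simp add: D_def A_def field_simps)
  have p': "deriv p_tilde 0 = of_real tau"
    by (rule DERIV_imp_deriv[OF has_field_derivative_p_tilde_0])
  have "tau \<noteq> 0" by (simp add: tau_def)
  have "norm (fps_nth D (n - 1)) \<le> norm (deriv p_tilde 0)"
  proof (rule subordinate_leading_coeff_bound[OF _ D])
    show "?F \<prec>\<^sub>s p_tilde" using assms(6) by (auto simp: class_R_def)
    show "fps_nth D k = 0" if "0 < k" "k < n - 1" for k
      using that assms(8)[of "Suc k"] by (simp add: D_nth b_def)
  qed (use \<open>tau \<noteq> 0\<close> p' assms in auto)
  moreover have "fps_nth D (n - 1) = of_real (\<rho> / \<mu> * real n * c n) * a n / \<gamma>"
    using assms D_nth[of "n - 1"] by (simp add: b_def)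
  ultimately have le: "norm (of_real (\<rho> / \<mu> * real n * c n) * a n / \<gamma>) \<le> \<bar>tau\<bar>"
    using p' by simp
  have c_eq: "\<rho> / \<mu> * real n * c n =
      real n * Gamma (\<rho> + 1) * Gamma (real n + \<mu>) / (Gamma (\<mu> + 1) * Gamma (real n + \<rho>))"
  proof -
    have "Gamma (\<rho> + 1) = \<rho> * Gamma \<rho>" "Gamma (\<mu> + 1) = \<mu> * Gamma \<mu>"
      by (rule Gamma_plus1; use assms \<mu> in \<open>auto simp: nonpos_Ints_def\<close>)+
    then show ?thesis by (simp add: c_def mult_ac)
  qed
  define p q where "p = real n * Gamma (\<rho> + 1) * Gamma (real n + \<mu>)"
    and "q = Gamma (\<mu> + 1) * Gamma (real n + \<rho>)"
  have "0 < p" "0 < q"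
    using assms \<mu> by (auto simp: p_def q_def intro!: mult_pos_pos Gamma_real_pos)
  moreover have "norm (of_real (p / q) * a n / \<gamma>) \<le> \<bar>tau\<bar>"
    using le unfolding c_eq p_def q_def .
  ultimately have "norm (a n) \<le> norm \<gamma> * \<bar>tau\<bar> * q / p"
    using \<open>\<gamma> \<noteq> 0\<close> by (simp add: norm_mult norm_divide field_simps)
  then show ?thesis by (simp only: p_def q_def mult.assoc)
qed

end
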